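(* Let $U \subseteq \mathbb{R}^K$ be open and convex, and let $Q : U \to \mathbb{R}^K$ be continuous and satisfy the law of demand. Then the following are equivalent: (i) $Q$ is injective, i.e. for each $y \in \mathbb{R}^K$ there is at most one $u \in U$ such that $Q(u) = y$. (ii) $Q$ is locally injective, i.e. for each $u \in U$ there is a neighborhood $H \subseteq \mathbb{R}^K$ of $u$ such that the restriction of $Q$ to $H$ (that is, to $H \cap U$) is injective. (iii) The only line segments in $U$ along which $Q$ is constant are singleton points.
   Context: A mapping $Q : U \subseteq \mathbb{R}^K \to \mathbb{R}^K$ satisfies the law of demand if for all $u, \tilde{u} \in U$, $(Q(u) - Q(\tilde{u})) \cdot (u - \tilde{u}) \geq 0$. A line segment is a set $\{(1-\alpha) a + \alpha b : \alpha \in [0,1]\}$ with $a, b \in \mathbb{R}^K$; it is a singleton point when $a = b$. *)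

theory Defs
  imports "HOL-Analysis.Analysis"
begin

definition law_of_demand :: "(real ^ 'k) set \<Rightarrow> (real ^ 'k \<Rightarrow> real ^ 'k) \<Rightarrow> bool" where
  "law_of_demand U Q \<longleftrightarrow> (\<forall>u\<in>U. \<forall>u'\<in>U. (Q u - Q u') \<bullet> (u - u') \<ge> 0)"

(* A neighbourhood of u is any set containing u in its interior; it need not be open
   or contained in U. *)
definition locally_injective_on ::
  "('a::topological_space \<Rightarrow> 'b) \<Rightarrow> 'a set \<Rightarrow> bool" where
  "locally_injective_on Q U \<longleftrightarrow> (\<forall>u\<in>U. \<exists>H. u \<in> interior H \<and> inj_on Q (H \<inter> U))"

end

(* The key point is Minty's characterisation: for a continuous monotone Q on an open set, Q u = y
   is equivalent to the family of inequalities (Q v - y) \<bullet> (v - u) \<ge> 0, v \<in> U, which are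
   affine in u. Hence the fibres of Q are convex, and two points with the same image span a segment
   on which Q is constant. *)
theory Submission
  imports Defs
begin

text \<open>Monotonicity gives the forward direction. Conversely, testing the inequalities at points
  approaching \<open>u\<close> along a ray and dividing by the step length leaves, by continuity, an
  inequality on \<open>Q u - y\<close> in the direction of the ray.\<close>

lemma law_of_demand_eq_iff_variational:
  fixes U :: "(real ^ 'k) set"
  assumes "open U" "continuous_on U Q" "law_of_demand U Q" "u \<in> U"
  shows "Q u = y \<longleftrightarrow> (\<forall>v\<in>U. (Q v - y) \<bullet> (v - u) \<ge> 0)"
proof
  assume "Q u = y"
  then show "\<forall>v\<in>U. (Q v - y) \<bullet> (v - u) \<ge> 0"
    using assms(3,4) unfolding law_of_demand_def by blast
next
  assume var: "\<forall>v\<in>U. (Q v - y) \<bullet> (v - u) \<ge> 0"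
  \<comment> \<open>With this direction the limiting inequality reads
    \<open>- (w \<bullet> w) \<ge> 0\<close>, which forces \<open>w = 0\<close>.\<close>
  define w where "w = y - Q u"
  have path: "((\<lambda>t. u + t *\<^sub>R w) \<longlongrightarrow> u) (at_right 0)"
    by (rule tendsto_eq_intros refl | simp)+
  have "isCont Q u"
    using assms by (simp add: continuous_on_eq_continuous_at)
  then have lim: "((\<lambda>t. (Q (u + t *\<^sub>R w) - y) \<bullet> w) \<longlongrightarrow> (Q u - y) \<bullet> w) (at_right 0)"
    by (intro tendsto_intros isCont_tendsto_compose[OF _ path])
  have "\<forall>\<^sub>F t in at_right 0. (Q (u + t *\<^sub>R w) - y) \<bullet> w \<ge> 0"
    using topological_tendstoD[OF path \<open>open U\<close> \<open>u \<in> U\<close>] eventually_at_right_less[of 0]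
  proof eventually_elim
    case (elim t)
    \<comment> \<open>For small \<open>t\<close> the point \<open>v = u + t *\<^sub>R w\<close> lies
      in the open set \<open>U\<close>, and \<open>v - u\<close> is \<open>t *\<^sub>R w\<close>;
      the factor \<open>t > 0\<close> is then cancelled.\<close>
    then have "t * ((Q (u + t *\<^sub>R w) - y) \<bullet> w) \<ge> 0"
      using var by fastforce
    then show ?case
      using elim(2) by (simp add: zero_le_mult_iff)
  qed
  then have "(Q u - y) \<bullet> w \<ge> 0"
    using tendsto_lowerbound[OF lim] by simp
  moreover have "(Q u - y) \<bullet> w = - (w \<bullet> w)"
    unfolding w_def by (metis inner_minus_left minus_diff_eq)
  ultimately have "w = 0"
    using inner_gt_zero_iff[of w] by fastforce
  then show "Q u = y"
    by (simp add: w_def)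
qed

lemma law_of_demand_convex_fibre:
  fixes U :: "(real ^ 'k) set"
  assumes "open U" "convex U" "continuous_on U Q" "law_of_demand U Q"
  shows "convex {u \<in> U. Q u = y}"
proof -
  have "{u \<in> U. Q u = y} = U \<inter> (\<Inter>v\<in>U. {u. (Q v - y) \<bullet> u \<le> (Q v - y) \<bullet> v})"
    using law_of_demand_eq_iff_variational[OF assms(1,3,4)]
    by (auto simp: inner_diff_right)
  then show ?thesis
    using assms(2) by (simp add: convex_Int convex_INT convex_halfspace_le)
qed

text \<open>A nondegenerate segment accumulates at its endpoint \<open>a\<close>, so any
  neighbourhood of \<open>a\<close> contains a second point of the segment, with the same value of
  \<open>Q\<close>.\<close>

lemma locally_injective_on_constant_segment:
  fixes a b :: "'a::real_normed_vector"
  assumes "locally_injective_on Q U" "closed_segment a b \<subseteq> U" "Q constant_on closed_segment a b"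
  shows "a = b"
proof (rule ccontr)
  assume "a \<noteq> b"
  obtain H where H: "a \<in> interior H" "inj_on Q (H \<inter> U)"
    using assms(1,2) unfolding locally_injective_on_def by (meson ends_in_segment(1) subsetD)
  \<comment> \<open>A connected set with more than one point has no isolated points.\<close>
  have "a islimpt closed_segment a b"
    using \<open>a \<noteq> b\<close> connected_imp_perfect[of "closed_segment a b" a]
    by (metis connected_segment(1) ends_in_segment(1,2) singletonD)
  then obtain c where c: "c \<in> closed_segment a b" "c \<in> interior H" "c \<noteq> a"
    using H(1) open_interior unfolding islimpt_def by blast
  have "Q c = Q a"
    using assms(3) c(1) ends_in_segment(1) unfolding constant_on_def by metis
  moreover have "a \<in> H \<inter> U" "c \<in> H \<inter> U"
    using assms(2) H(1) c interior_subset ends_in_segment(1) by blast+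
  ultimately show False
    using H(2) c(3) by (metis inj_onD)
qed

theorem proposition1:
  fixes U :: "(real ^ 'k) set" and Q :: "real ^ 'k \<Rightarrow> real ^ 'k"
  assumes "open U" and "convex U"
    and "continuous_on U Q"
    and "law_of_demand U Q"
  shows "(inj_on Q U \<longleftrightarrow> locally_injective_on Q U) \<and>
    (locally_injective_on Q U \<longleftrightarrow>
      (\<forall>a b. closed_segment a b \<subseteq> U \<and> Q constant_on closed_segment a b \<longrightarrow> a = b))"
    (is "(?inj \<longleftrightarrow> ?loc) \<and> (?loc \<longleftrightarrow> ?seg)")
proof -
  have "?loc" if ?inj
    \<comment> \<open>The whole space serves as the neighbourhood \<open>H\<close> of every
      point.\<close>
    using that unfolding locally_injective_on_def by (metis Int_UNIV_left UNIV_I interior_UNIV)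
  moreover have "?seg" if ?loc
    using locally_injective_on_constant_segment[OF that] by blast
  moreover have "?inj" if seg: ?seg
  proof (rule inj_onI)
    fix a b assume "a \<in> U" "b \<in> U" "Q a = Q b"
    \<comment> \<open>Both endpoints lie in the fibre over \<open>Q b\<close>, which is
      convex.\<close>
    then have "closed_segment a b \<subseteq> {u \<in> U. Q u = Q b}"
      using law_of_demand_convex_fibre[OF assms] by (intro closed_segment_subset) auto
    then have "closed_segment a b \<subseteq> U" "Q constant_on closed_segment a b"
      unfolding constant_on_def by blast+
    then show "a = b"
      using seg by blast
  qed
  ultimately show ?thesis
    by blast
qed

end
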